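(* Let $G$ be a finite abelian group with $|G|=m$ and let $A\subseteq G$. If $R_A(g)\le 5$ for all $g\in G$, then $$|\{g\in G:\ R_A(g)=0\}|\ \ge\ \frac{1}{4}m-\sqrt{5m}.$$
   Context: For a subset $A$ of an abelian group $G$ (written additively) and $g\in G$, $R_A(g)$ denotes the number of ordered pairs $(a,a')\in A\times A$ with $a+a'=g$. *)

theory Defs
  imports Complex_Main "HOL-Library.Cardinality"
begin

definition rep_count :: "'a::ab_group_add set \<Rightarrow> 'a \<Rightarrow> nat" where
  "rep_count A g = card {(a, a') \<in> A \<times> A. a + a' = g}"

end

theory Submission
  imports Defs
begin

text \<open>
  Let \<open>n = card A\<close>, so that \<open>n\<^sup>2 = (\<Sum>g. R g) \<le> 5 * m\<close>. The involution \<open>(a, a') \<mapsto> (a', a)\<close> shows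
  that \<open>R g\<close> is odd only for \<open>g\<close> of the form \<open>a + a\<close>, hence for at most \<open>n\<close> elements. Apart from
  these, \<open>R g \<in> {0, 2, 4}\<close> and the indicator of \<open>R g = 0\<close> equals \<open>(R g - 2) * (R g - 4) / 8\<close>.
  Summing it requires a lower bound for the additive energy \<open>(\<Sum>g. (R g)\<^sup>2) = (\<Sum>d. (r d)\<^sup>2)\<close>, where
  \<open>r d\<close> counts the representations of \<open>d\<close> as a difference. Cauchy--Schwarz would only give the
  constant \<open>7/32\<close>; the integrality bound \<open>(r d - 2) * (r d - 3) \<ge> 0\<close> for \<open>d \<noteq> 0\<close> yields \<open>1/4\<close>.
\<close>

lemma sum_card_fibres:
  fixes f :: "'b \<Rightarrow> 'a::finite"
  assumes "finite S"
  shows "(\<Sum>g\<in>UNIV. card {x \<in> S. f x = g}) = card S"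
proof -
  have "card (\<Union>g\<in>UNIV. {x \<in> S. f x = g}) = (\<Sum>g\<in>UNIV. card {x \<in> S. f x = g})"
    by (rule card_UN_disjoint) (use assms in auto)
  moreover have "(\<Union>g\<in>UNIV. {x \<in> S. f x = g}) = S" by auto
  ultimately show ?thesis by simp
qed

lemma sum_card_fibres_squared:
  fixes f :: "'b \<Rightarrow> 'a::finite"
  assumes "finite S"
  shows "(\<Sum>g\<in>UNIV. (card {x \<in> S. f x = g})\<^sup>2) = card {(x, y) \<in> S \<times> S. f x = f y}"
proof -
  have "card (\<Union>g\<in>UNIV. {x \<in> S. f x = g} \<times> {x \<in> S. f x = g})
      = (\<Sum>g\<in>UNIV. card ({x \<in> S. f x = g} \<times> {x \<in> S. f x = g}))"
    by (rule card_UN_disjoint) (use assms in auto)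
  moreover have "(\<Union>g\<in>UNIV. {x \<in> S. f x = g} \<times> {x \<in> S. f x = g}) = {(x, y) \<in> S \<times> S. f x = f y}"
    by auto
  ultimately show ?thesis by (simp add: card_cartesian_product power2_eq_square)
qed

definition diff_count :: "'a::ab_group_add set \<Rightarrow> 'a \<Rightarrow> nat" where
  "diff_count A d = card {(a, a') \<in> A \<times> A. a - a' = d}"

lemma rep_count_fibre: "rep_count A g = card {p \<in> A \<times> A. fst p + snd p = g}"
  unfolding rep_count_def by (rule arg_cong[where f = card]) auto

lemma diff_count_fibre: "diff_count A d = card {p \<in> A \<times> A. fst p - snd p = d}"
  unfolding diff_count_def by (rule arg_cong[where f = card]) auto

lemma sum_rep_count:
  fixes A :: "'a::{finite, ab_group_add} set"
  shows "(\<Sum>g\<in>UNIV. rep_count A g) = (card A)\<^sup>2"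
  unfolding rep_count_fibre
  by (subst sum_card_fibres) (simp_all add: card_cartesian_product power2_eq_square)

lemma sum_diff_count:
  fixes A :: "'a::{finite, ab_group_add} set"
  shows "(\<Sum>d\<in>UNIV. diff_count A d) = (card A)\<^sup>2"
  unfolding diff_count_fibre
  by (subst sum_card_fibres) (simp_all add: card_cartesian_product power2_eq_square)

lemma diff_count_0: "diff_count A 0 = card A"
proof -
  have "{(a, a') \<in> A \<times> A. a - a' = 0} = (\<lambda>a. (a, a)) ` A" by auto
  then show ?thesis unfolding diff_count_def by (simp add: card_image inj_on_def)
qed

text \<open>Both sides count additive quadruples: \<open>a + b = c + d\<close> is the same equation
  as \<open>a - c = d - b\<close>, so regrouping the four entries is a bijection.\<close>

lemma sum_rep_count_squared:
  fixes A :: "'a::{finite, ab_group_add} set"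
  shows "(\<Sum>g\<in>UNIV. (rep_count A g)\<^sup>2) = (\<Sum>d\<in>UNIV. (diff_count A d)\<^sup>2)"
proof -
  let ?S = "{(x, y) \<in> (A \<times> A) \<times> (A \<times> A). fst x + snd x = fst y + snd y}"
  let ?D = "{(x, y) \<in> (A \<times> A) \<times> (A \<times> A). fst x - snd x = fst y - snd y}"
  have "bij_betw (\<lambda>((a, b), (c, d)). ((a, c), (d, b))) ?S ?D"
    by (rule bij_betw_byWitness[where f' = "\<lambda>((a, c), (d, b)). ((a, b), (c, d))"]) (auto simp: algebra_simps)
  then have "card ?S = card ?D" by (rule bij_betw_same_card)
  then show ?thesis
    unfolding rep_count_fibre diff_count_fibre by (simp add: sum_card_fibres_squared)
qed

lemma odd_rep_count_imp_double:
  fixes A :: "'a::{finite, ab_group_add} set"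
  assumes "odd (rep_count A g)"
  shows "g \<in> (\<lambda>a. a + a) ` A"
proof (rule ccontr)
  assume g: "g \<notin> (\<lambda>a. a + a) ` A"
  \<comment> \<open>The group carries no order, so an injection into \<open>nat\<close> supplies
    one. As \<open>g\<close> is not a double, no pair is diagonal, and the swap exchanges the halves
    \<open>?L\<close> and \<open>?U\<close>.\<close>
  obtain f :: "'a \<Rightarrow> nat" where f: "inj f"
    using finite_imp_inj_to_nat_seg[of "UNIV :: 'a set"] by auto
  let ?L = "{(a, a') \<in> A \<times> A. a + a' = g \<and> f a < f a'}"
  let ?U = "{(a, a') \<in> A \<times> A. a + a' = g \<and> f a' < f a}"
  have "f a \<noteq> f a'" if "a \<in> A" "a + a' = g" for a a'
    using that g f by (auto dest: injD)
  then have "{(a, a') \<in> A \<times> A. a + a' = g} = ?L \<union> ?U"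
    by (auto simp: neq_iff)
  moreover have "card (?L \<union> ?U) = card ?L + card ?U"
    by (rule card_Un_disjoint) auto
  moreover have "bij_betw prod.swap ?L ?U"
    by (rule bij_betw_byWitness[where f' = prod.swap]) (auto simp: add.commute)
  then have "card ?L = card ?U" by (rule bij_betw_same_card)
  ultimately show False using assms by (simp add: rep_count_def)
qed

lemma card_odd_rep_count_le:
  fixes A :: "'a::{finite, ab_group_add} set"
  shows "card {g. odd (rep_count A g)} \<le> card A"
proof -
  have "card {g. odd (rep_count A g)} \<le> card ((\<lambda>a. a + a) ` A)"
    by (rule card_mono) (auto dest: odd_rep_count_imp_double)
  also have "\<dots> \<le> card A" by (rule card_image_le) simp
  finally show ?thesis .
qed

text \<open>The difference 0 alone contributes \<open>n^2\<close>, where \<open>n = card A\<close>;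
  the others contribute at least \<open>5 * (n^2 - n) - 6 * (m - 1)\<close>, with \<open>m\<close>
  the group order. The slope 5 is chosen so that the total \<open>6 * n^2\<close> later cancels the
  linear term \<open>6 * R g\<close>.\<close>

lemma energy_lower_bound:
  fixes A :: "'a::{finite, ab_group_add} set"
  shows "(\<Sum>g\<in>UNIV. (int (rep_count A g))\<^sup>2)
    \<ge> 6 * (int (card A))\<^sup>2 - 5 * int (card A) - 6 * (int CARD('a) - 1)"
proof -
  define r where "r d = int (diff_count A d)" for d
  have split: "(\<Sum>d\<in>UNIV. h d) = h 0 + (\<Sum>d\<in>UNIV - {0}. h d)" for h :: "'a \<Rightarrow> int"
    by (rule sum.remove) auto
  have r0: "r 0 = int (card A)" by (simp add: r_def diff_count_0)
  have quad: "5 * k - 6 \<le> k\<^sup>2" for k :: int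
  proof -
    \<comment> \<open>A product of two consecutive integers is never negative.\<close>
    have "0 \<le> (k - 2) * (k - 3)" by (cases "k \<le> 2") (auto simp: mult_nonpos_nonpos)
    then show ?thesis by (simp add: algebra_simps power2_eq_square)
  qed
  have "(\<Sum>d\<in>UNIV. r d) = (int (card A))\<^sup>2"
    using arg_cong[OF sum_diff_count[of A], of int] by (simp add: r_def)
  then have "(\<Sum>d\<in>UNIV - {0}. r d) = (int (card A))\<^sup>2 - int (card A)"
    using split[of r] r0 by simp
  then have "5 * ((int (card A))\<^sup>2 - int (card A)) - 6 * (int CARD('a) - 1)
      = (\<Sum>d\<in>UNIV - {0}. 5 * r d - 6)"
    by (simp add: sum_subtractf card_Diff_singleton of_nat_diff Suc_leI flip: sum_distrib_left)
  also have "\<dots> \<le> (\<Sum>d\<in>UNIV - {0}. (r d)\<^sup>2)" by (intro sum_mono quad)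
  also have "\<dots> = (\<Sum>d\<in>UNIV. (r d)\<^sup>2) - (int (card A))\<^sup>2"
    using split[of "\<lambda>d. (r d)\<^sup>2"] r0 by simp
  also have "(\<Sum>d\<in>UNIV. (r d)\<^sup>2) = (\<Sum>g\<in>UNIV. (int (rep_count A g))\<^sup>2)"
    using arg_cong[OF sum_rep_count_squared[of A], of int] by (simp add: r_def)
  finally show ?thesis by (simp add: algebra_simps)
qed

theorem theorem1p1:
  fixes A :: "'a::{finite, ab_group_add} set" and m :: nat
  assumes "CARD('a) = m"
    and "\<And>g. rep_count A g \<le> 5"
  shows "real (card {g. rep_count A g = 0}) \<ge> 1 / 4 * real m - sqrt (5 * real m)"
proof -
  define R where "R g = int (rep_count A g)" for g
  define n where "n = int (card A)"
  let ?Z = "int (card {g. rep_count A g = 0})"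
  have sumR: "(\<Sum>g\<in>UNIV. R g) = n\<^sup>2"
    using arg_cong[OF sum_rep_count[of A], of int] by (simp add: R_def n_def)
  \<comment> \<open>The quadratic is \<open>(R g - 2) * (R g - 4)\<close>: it is 8 at 0, vanishes at
    2 and 4, and takes the values 3, -1, 3 at 1, 3, 5. Hence the correction 3 for odd
    counts.\<close>
  have "(R g)\<^sup>2 - 6 * R g + 8 - 3 * of_bool (odd (rep_count A g))
      \<le> 8 * of_bool (rep_count A g = 0)" for g
  proof -
    have "rep_count A g \<in> {0, 1, 2, 3, 4, 5}" using assms(2)[of g] by auto
    then show ?thesis by (auto simp: R_def)
  qed
  then have "(\<Sum>g\<in>UNIV. (R g)\<^sup>2 - 6 * R g + 8 - 3 * of_bool (odd (rep_count A g)))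
      \<le> (\<Sum>g\<in>UNIV. 8 * of_bool (rep_count A g = 0))"
    by (rule sum_mono)
  then have "(\<Sum>g\<in>UNIV. (R g)\<^sup>2) - 6 * n\<^sup>2 + 8 * int m - 3 * int (card {g. odd (rep_count A g)})
      \<le> 8 * ?Z"
    using sumR assms(1)
    by (simp add: sum.distrib sum_subtractf sum_of_bool_eq flip: sum_distrib_left)
  moreover have "int (card {g. odd (rep_count A g)}) \<le> n"
    unfolding n_def using card_odd_rep_count_le[of A] by simp
  moreover have "(\<Sum>g\<in>UNIV. (R g)\<^sup>2) \<ge> 6 * n\<^sup>2 - 5 * n - 6 * (int m - 1)"
    using energy_lower_bound[of A] assms(1) by (simp add: R_def n_def)
  \<comment> \<open>The terms \<open>6 * n^2\<close> cancel, \<open>8 * m - 6 * (m - 1)\<close>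
    leaves \<open>2 * m + 6\<close>, and the losses \<open>5 * n\<close> and \<open>3 * n\<close>
    add up to \<open>8 * n\<close>; the surplus 6 is dropped.\<close>
  ultimately have "2 * int m - 8 * n \<le> 8 * ?Z" by (simp add: algebra_simps)
  then have "2 * real m - 8 * real (card A) \<le> 8 * real (card {g. rep_count A g = 0})"
    unfolding n_def by linarith
  moreover have "(card A)\<^sup>2 \<le> 5 * m"
    using sum_mono[of UNIV "rep_count A" "\<lambda>_. 5"] assms by (simp add: sum_rep_count)
  then have "(real (card A))\<^sup>2 \<le> 5 * real m"
    by (metis of_nat_le_iff of_nat_mult of_nat_numeral of_nat_power)
  then have "real (card A) \<le> sqrt (5 * real m)" by (rule real_le_rsqrt)
  ultimately show ?thesis by linarith
qed

end
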